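(* For every $D>0$ there exists a constant $c_D>0$, depending only on $D$, such that $$\mathcal{F}_{\mathbb{Z}^d}g_t(\xi)\le\exp\big(-c_De^{-\pi/t}|\xi|^2\big)$$ for all $d\in\mathbb{Z}_+$, all $0<t\le D$ and all $\xi\in\mathbb{T}^d$.
   Context: $\mathbb{Z}_+=\{1,2,\dots\}$. The torus $\mathbb{T}^d=\mathbb{R}^d/\mathbb{Z}^d$ is identified with $[-1/2,1/2)^d$, and $|\xi|$ is the Euclidean norm of the representative in $[-1/2,1/2)^d$. For $t>0$, $g_t:\mathbb{Z}^d\to\mathbb{R}$ is the discrete normalized Gaussian $$g_t(n)=\frac{\exp(-\pi|n|^2/t)}{\sum_{k\in\mathbb{Z}^d}\exp(-\pi|k|^2/t)},$$ and for $f\in\ell^1(\mathbb{Z}^d)$, $\mathcal{F}_{\mathbb{Z}^d}f(\xi)=\sum_{n\in\mathbb{Z}^d}f(n)e^{2\pi i n\cdot\xi}$. (The function $\mathcal{F}_{\mathbb{Z}^d}g_t$ is real-valued by symmetry.) *)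

theory Defs
  imports "HOL-Analysis.Analysis"
begin

text \<open>
  The dimension is quantified inside the statement (the constant must not depend on it), so it is
  a natural number and not an index type: points of a \<open>d\<close>-dimensional space are functions on
  \<open>{..<d}\<close>, extended by \<open>undefined\<close> elsewhere so that each point has exactly one representative.
\<close>

definition lattice :: "nat \<Rightarrow> (nat \<Rightarrow> int) set" where
  "lattice d = {..<d} \<rightarrow>\<^sub>E UNIV"

text \<open>The torus, identified with the fundamental domain \<open>[-1/2, 1/2)\<close> to the power \<open>d\<close>.\<close>

definition torus :: "nat \<Rightarrow> (nat \<Rightarrow> real) set" where
  "torus d = {..<d} \<rightarrow>\<^sub>E {-1/2..<1/2}"

definition euclid_norm :: "nat \<Rightarrow> (nat \<Rightarrow> real) \<Rightarrow> real" where
  "euclid_norm d x = L2_set x {..<d}"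

definition gauss_weight :: "nat \<Rightarrow> real \<Rightarrow> (nat \<Rightarrow> int) \<Rightarrow> real" where
  "gauss_weight d t n = exp (- pi * (euclid_norm d (\<lambda>i. real_of_int (n i)))\<^sup>2 / t)"

definition discrete_gaussian :: "nat \<Rightarrow> real \<Rightarrow> (nat \<Rightarrow> int) \<Rightarrow> real" where
  "discrete_gaussian d t n = gauss_weight d t n / (\<Sum>\<^sub>\<infinity>k\<in>lattice d. gauss_weight d t k)"

definition fourier :: "nat \<Rightarrow> ((nat \<Rightarrow> int) \<Rightarrow> complex) \<Rightarrow> (nat \<Rightarrow> real) \<Rightarrow> complex" where
  "fourier d f \<xi> =
     (\<Sum>\<^sub>\<infinity>n\<in>lattice d. f n * exp (2 * pi * \<i> * of_real (\<Sum>i<d. real_of_int (n i) * \<xi> i)))"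

text \<open>
  The Fourier transform is complex-valued in general; by the following fact, nothing is lost in
  taking the real part of that of the Gaussian.
\<close>

lemma fourier_discrete_gaussian_real:
  "fourier d (\<lambda>n. complex_of_real (discrete_gaussian d t n)) \<xi> \<in> \<real>"
proof -
  define m :: "(nat \<Rightarrow> int) \<Rightarrow> nat \<Rightarrow> int" where "m n = (\<lambda>i\<in>{..<d}. - n i)" for n
  define F where "F n = complex_of_real (discrete_gaussian d t n) *
      exp (2 * pi * \<i> * of_real (\<Sum>i<d. real_of_int (n i) * \<xi> i))" for n
  have mm: "m n \<in> lattice d" for n
    by (auto simp: m_def lattice_def)
  have inv: "m (m n) = n" if "n \<in> lattice d" for n
    using that by (auto simp: m_def lattice_def fun_eq_iff PiE_def extensional_def)
  have bij: "bij_betw m (lattice d) (lattice d)"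
    by (rule bij_betw_byWitness[where f' = m]) (auto simp: inv mm)
  have F_m: "F (m n) = cnj (F n)" for n
  proof -
    have "gauss_weight d t (m n) = gauss_weight d t n"
      by (simp add: gauss_weight_def euclid_norm_def L2_set_def m_def)
    moreover have "(\<Sum>i<d. real_of_int (m n i) * \<xi> i) = - (\<Sum>i<d. real_of_int (n i) * \<xi> i)"
      by (simp add: m_def sum_negf)
    ultimately show ?thesis
      by (simp add: F_def discrete_gaussian_def exp_cnj del: of_real_sum)
  qed
  have "infsum F (lattice d) = infsum (\<lambda>n. F (m n)) (lattice d)"
    by (rule infsum_reindex_bij_betw[OF bij, symmetric])
  also have "\<dots> = cnj (infsum F (lattice d))"
    by (simp add: F_m infsum_cnj)
  finally have "infsum F (lattice d) \<in> \<real>"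
    by (simp add: Reals_cnj_iff)
  thus ?thesis
    by (simp add: fourier_def F_def[abs_def])
qed

end

theory Submission
  imports Defs
begin

text \<open>
  The Gaussian weight is a product over the coordinates, so its Fourier transform is the product of
  the one-dimensional transforms at the coordinates of \<open>\<xi>\<close> (\<open>fourier_discrete_gaussian\<close>), and
  \<open>\<bar>\<xi>\<bar>\<^sup>2\<close> is additive over the coordinates. Bounding the modulus of a one-dimensional factor by
  \<open>exp (- c * exp (- pi / t) * x\<^sup>2)\<close> therefore gives the bound in every dimension with the same
  \<open>c\<close>. Working with moduli makes the signs of the factors irrelevant.

  In dimension one, put \<open>p k = exp (- pi * k\<^sup>2 / t)\<close> and let \<open>\<Theta>(t)\<close> be the sum of all \<open>p k\<close>. In the
  sum of the \<open>p k * exp (2 * pi * \<i> * k * x)\<close> only the cancellation between \<open>k = 0\<close> and \<open>k = 1\<close> is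
  exploited: these two frequencies interfere, and all the others are bounded trivially
  (\<open>norm_infsum_cis_le\<close>). The loss against \<open>\<Theta>(t)\<close> is at least
  \<open>2 * p 1 * (1 - cos (pi * x))\<close>, which is at least \<open>4 * exp (- pi / t) * x\<^sup>2\<close> for
  \<open>\<bar>x\<bar> \<le> 1/2\<close>. Dividing by \<open>\<Theta>(t)\<close>, which increases with \<open>t\<close>, and using \<open>1 - u \<le> exp (- u)\<close> shows
  that \<open>c = 4 / \<Theta>(D)\<close> works.
\<close>

section \<open>Interference of two neighbouring frequencies\<close>

text \<open>
  By the mean value theorem \<open>sin z\<close> is at least \<open>z * cos (pi / 4)\<close> on \<open>[0, pi / 4]\<close>; this is applied
  to \<open>1 - cos y = 2 * (sin (y / 2))\<^sup>2\<close>.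
\<close>

lemma one_minus_cos_ge:
  fixes y :: real
  assumes "\<bar>y\<bar> \<le> pi / 2"
  shows "y\<^sup>2 / 4 \<le> 1 - cos y"
proof -
  define z where "z = \<bar>y\<bar> / 2"
  have z: "0 \<le> z" "z \<le> pi / 4"
    using assms by (auto simp: z_def)
  have "z * (sqrt 2 / 2) \<le> sin z"
  proof (cases "z = 0")
    case False
    then have "0 < z" using z by simp
    then obtain u where u: "0 < u" "u < z" and eq: "sin z - sin 0 = (z - 0) * cos u"
      using MVT2[of 0 z sin cos] by (auto intro: derivative_eq_intros)
    have "cos (pi / 4) \<le> cos u"
      using u z by (intro cos_monotone_0_pi_le) auto
    then have "z * (sqrt 2 / 2) \<le> z * cos u"
      using z by (intro mult_left_mono) (auto simp: cos_45)
    then show ?thesis using eq by simp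
  qed simp
  then have "(z * (sqrt 2 / 2))\<^sup>2 \<le> (sin z)\<^sup>2"
    using z by (intro power_mono) auto
  moreover have "cos y = 1 - 2 * (sin z)\<^sup>2"
    using cos_double_sin[of z] by (simp add: z_def)
  ultimately show ?thesis
    by (simp add: z_def power_mult_distrib power_divide)
qed

lemma norm_one_plus_cis: "norm (1 + cis (2 * y)) = 2 * \<bar>cos y\<bar>"
proof -
  have "1 + cis (2 * y) = cis y * complex_of_real (2 * cos y)"
  proof -
    have "cis (2 * y) = cis y * cis y" by (simp add: cis_mult)
    moreover have "1 = cis y * cis (- y)" by (simp add: cis_mult)
    moreover have "cis y + cis (- y) = complex_of_real (2 * cos y)"
      by (simp add: complex_eq_iff)
    ultimately show ?thesis by (metis distrib_left add.commute)
  qed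
  then show ?thesis
    by (simp add: norm_mult del: of_real_mult)
qed

text \<open>
  The terms at \<open>0\<close> and \<open>1\<close> combine to \<open>(p 0 - p 1) + p 1 * (1 + cis (2 * y))\<close>. The first summand
  has modulus \<open>p 0 - p 1\<close> because \<open>p 1 \<le> p 0\<close>, and \<open>1 + cis (2 * y)\<close> has modulus \<open>2 * cos y\<close> instead
  of the trivial bound \<open>2\<close>, which is the gain; the remaining terms are bounded by their moduli.
\<close>

lemma norm_infsum_cis_le:
  fixes p :: "int \<Rightarrow> real" and y :: real
  assumes nonneg: "\<And>k. 0 \<le> p k" and summable: "p summable_on UNIV" and "p 1 \<le> p 0"
    and "\<bar>y\<bar> \<le> pi / 2"
  shows "norm (\<Sum>\<^sub>\<infinity>k. complex_of_real (p k) * cis (2 * of_int k * y))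
           \<le> (\<Sum>\<^sub>\<infinity>k. p k) - 2 * p 1 * (1 - cos y)"
proof -
  define f where "f k = complex_of_real (p k) * cis (2 * of_int k * y)" for k
  define R :: "int set" where "R = UNIV - {0, 1}"
  have norm_f: "norm (f k) = p k" for k
    using nonneg[of k] by (simp add: f_def norm_mult)
  have p_R: "p summable_on R"
    by (rule summable_on_subset[OF summable]) simp
  have f_R: "(\<lambda>k. norm (f k)) summable_on R"
    using p_R by (simp add: norm_f)
  have U: "(UNIV :: int set) = {0, 1} \<union> R" "{0, 1} \<inter> R = {}"
    by (auto simp: R_def)
  have split_f: "infsum f UNIV = (f 0 + f 1) + infsum f R"
    using abs_summable_summable[OF f_R]
    by (subst U(1), subst infsum_Un_disjoint) (auto simp: U(2))
  have split_p: "infsum p UNIV = (p 0 + p 1) + infsum p R"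
    using p_R by (subst U(1), subst infsum_Un_disjoint) (auto simp: U(2))
  have "0 \<le> cos y"
    using assms(4) by (intro cos_ge_zero) auto
  have "f 0 + f 1 = complex_of_real (p 0 - p 1) + complex_of_real (p 1) * (1 + cis (2 * y))"
    by (simp add: f_def algebra_simps)
  then have "norm (f 0 + f 1) \<le> norm (complex_of_real (p 0 - p 1))
      + norm (complex_of_real (p 1) * (1 + cis (2 * y)))"
    by (metis norm_triangle_ineq)
  also have "\<dots> = (p 0 - p 1) + p 1 * (2 * cos y)"
    using \<open>p 1 \<le> p 0\<close> \<open>0 \<le> cos y\<close> nonneg[of 1]
    by (simp add: norm_mult norm_one_plus_cis del: of_real_diff)
  finally have "norm (f 0 + f 1) \<le> (p 0 + p 1) - 2 * p 1 * (1 - cos y)"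
    by (simp add: algebra_simps)
  moreover have "norm (infsum f R) \<le> infsum p R"
    using norm_infsum_bound[OF f_R] by (simp add: norm_f)
  moreover have "norm (infsum f UNIV) \<le> norm (f 0 + f 1) + norm (infsum f R)"
    unfolding split_f by (rule norm_triangle_ineq)
  ultimately have "norm (infsum f UNIV) \<le> infsum p UNIV - 2 * p 1 * (1 - cos y)"
    unfolding split_p by linarith
  then show ?thesis
    by (simp add: f_def[abs_def])
qed

section \<open>The one-dimensional Gaussian\<close>

definition int_gauss :: "real \<Rightarrow> int \<Rightarrow> real" where
  "int_gauss t k = exp (- pi * (of_int k)\<^sup>2 / t)"

lemma int_gauss_pos [simp]: "0 < int_gauss t k"
  by (simp add: int_gauss_def)

lemma abs_int_gauss [simp]: "\<bar>int_gauss t k\<bar> = int_gauss t k"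
  by (simp add: abs_of_pos)

definition int_gauss_mass :: "real \<Rightarrow> real" where
  "int_gauss_mass t = (\<Sum>\<^sub>\<infinity>k. int_gauss t k)"

definition int_gauss_fourier :: "real \<Rightarrow> real \<Rightarrow> complex" where
  "int_gauss_fourier t x =
     (\<Sum>\<^sub>\<infinity>k. complex_of_real (int_gauss t k) * cis (2 * of_int k * (pi * x)))"

text \<open>Since \<open>k\<^sup>2 \<ge> \<bar>k\<bar>\<close> for integers, both halves are dominated by a geometric series.\<close>

lemma summable_int_gauss:
  assumes "0 < t"
  shows "int_gauss t summable_on UNIV"
proof -
  have "summable (\<lambda>n. exp (- pi / t) ^ n)"
    using assms by (intro summable_geometric) simp
  then have geo: "(\<lambda>n. exp (- pi / t) ^ n) summable_on UNIV"
    by (subst summable_on_UNIV_nonneg_real_iff) auto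
  have le: "int_gauss t k \<le> exp (- pi / t) ^ n" if "\<bar>k\<bar> = int n" for k n
  proof -
    have "real n \<le> (real n)\<^sup>2"
      by (cases n) (auto simp: power2_eq_square)
    moreover have "(of_int k :: real)\<^sup>2 = (real n)\<^sup>2"
      using that by (metis of_int_abs of_int_of_nat_eq power2_abs)
    ultimately have "- pi * (of_int k)\<^sup>2 / t \<le> real n * (- pi / t)"
      using assms by (simp add: field_simps)
    then show ?thesis
      by (simp add: int_gauss_def flip: exp_of_nat_mult)
  qed
  have half: "int_gauss t summable_on range h" if "inj h" "\<And>n. \<bar>h n\<bar> = int n" for h
  proof -
    have "(int_gauss t \<circ> h) summable_on UNIV"
    proof (rule summable_on_comparison_test[OF geo])
      show "(int_gauss t \<circ> h) n \<le> exp (- pi / t) ^ n" for n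
        using le[OF that(2)] by simp
    qed (simp add: int_gauss_def)
    then show ?thesis
      using summable_on_reindex[OF that(1)] by blast
  qed
  have "int_gauss t summable_on (range int \<union> range (\<lambda>n. - int n))"
    by (intro summable_on_union half) (auto simp: inj_on_def)
  moreover have "range int \<union> range (\<lambda>n. - int n) = UNIV"
    by (auto simp: image_iff) (metis int_cases2)
  ultimately show ?thesis by simp
qed

lemma int_gauss_mass_pos:
  assumes "0 < t"
  shows "0 < int_gauss_mass t"
proof -
  have "sum (int_gauss t) {0} \<le> int_gauss_mass t"
    unfolding int_gauss_mass_def
    by (rule finite_sum_le_infsum[OF summable_int_gauss[OF assms]]) (auto simp: int_gauss_def)
  then show ?thesis by (simp add: int_gauss_def)
qed

lemma int_gauss_mass_mono:
  assumes "0 < s" "s \<le> t"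
  shows "int_gauss_mass s \<le> int_gauss_mass t"
  unfolding int_gauss_mass_def
proof (rule infsum_mono)
  show "int_gauss s k \<le> int_gauss t k" for k
    using assms by (auto simp: int_gauss_def intro!: divide_left_mono)
qed (use assms summable_int_gauss in auto)

lemma norm_int_gauss_fourier_le:
  assumes "0 < t" "\<bar>x\<bar> \<le> 1 / 2"
  shows "norm (int_gauss_fourier t x) / int_gauss_mass t
           \<le> exp (- (4 / int_gauss_mass t) * exp (- pi / t) * x\<^sup>2)"
proof -
  have y: "\<bar>pi * x\<bar> \<le> pi / 2"
    using assms by (simp add: abs_mult)
  have "norm (int_gauss_fourier t x)
      \<le> int_gauss_mass t - 2 * int_gauss t 1 * (1 - cos (pi * x))"
    unfolding int_gauss_fourier_def int_gauss_mass_def using assms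
    by (intro norm_infsum_cis_le y summable_int_gauss) (auto simp: int_gauss_def)
  also have "\<dots> \<le> int_gauss_mass t - 2 * int_gauss t 1 * (2 * x\<^sup>2)"
  proof -
    \<comment> \<open>The bound \<open>pi \<ge> 3\<close> gives \<open>pi\<^sup>2 / 4 \<ge> 2\<close>.\<close>
    have "3 * 3 \<le> pi * pi"
      using pi_gt3 by (intro mult_mono) auto
    then have "8 * x\<^sup>2 \<le> pi\<^sup>2 * x\<^sup>2"
      by (intro mult_right_mono) (auto simp: power2_eq_square)
    then have "2 * x\<^sup>2 \<le> 1 - cos (pi * x)"
      using one_minus_cos_ge[OF y] by (simp add: power_mult_distrib)
    then show ?thesis
      by (simp add: int_gauss_def)
  qed
  finally have "norm (int_gauss_fourier t x) / int_gauss_mass t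
      \<le> 1 + - (4 / int_gauss_mass t) * exp (- pi / t) * x\<^sup>2"
    using int_gauss_mass_pos[OF assms(1)] by (simp add: int_gauss_def field_simps)
  also have "\<dots> \<le> exp (- (4 / int_gauss_mass t) * exp (- pi / t) * x\<^sup>2)"
    by (rule exp_ge_add_one_self)
  finally show ?thesis .
qed

section \<open>Reduction to dimension one\<close>

lemma euclid_norm_power2: "(euclid_norm d x)\<^sup>2 = (\<Sum>i<d. (x i)\<^sup>2)"
  by (simp add: euclid_norm_def L2_set_def sum_nonneg)

lemma gauss_weight_eq_prod: "gauss_weight d t n = (\<Prod>i<d. int_gauss t (n i))"
proof -
  have "- pi * (\<Sum>i<d. (real_of_int (n i))\<^sup>2) / t = (\<Sum>i<d. - pi * (real_of_int (n i))\<^sup>2 / t)"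
    by (simp only: sum_distrib_left sum_divide_distrib)
  then show ?thesis
    unfolding gauss_weight_def euclid_norm_power2 int_gauss_def by (simp only: exp_sum finite_lessThan)
qed

text \<open>
  Both the weights and the characters are products over the coordinates, and all sums converge
  absolutely, so the sum over the lattice of the products is the product of the sums over the
  integers; this applies to the normalising constant and to the transform alike.
\<close>

lemma fourier_discrete_gaussian:
  assumes "0 < t"
  shows "fourier d (\<lambda>n. complex_of_real (discrete_gaussian d t n)) \<xi>
    = (\<Prod>i<d. int_gauss_fourier t (\<xi> i) / complex_of_real (int_gauss_mass t))"
proof -
  let ?e = "\<lambda>i k. complex_of_real (int_gauss t k) * cis (2 * of_int k * (pi * \<xi> i))"
  have summ: "int_gauss t summable_on UNIV"
    by (rule summable_int_gauss[OF assms])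
  have mass: "(\<Sum>\<^sub>\<infinity>k\<in>lattice d. gauss_weight d t k) = int_gauss_mass t ^ d"
    unfolding gauss_weight_eq_prod lattice_def int_gauss_mass_def
    by (subst infsum_prod_PiE_abs) (use summ in auto)
  have char: "exp (2 * pi * \<i> * of_real (\<Sum>i<d. real_of_int (n i) * \<xi> i))
      = (\<Prod>i<d. cis (2 * of_int (n i) * (pi * \<xi> i)))" for n
  proof -
    have "cis (2 * of_int (n i) * (pi * \<xi> i)) = exp (2 * pi * \<i> * of_real (real_of_int (n i) * \<xi> i))"
      for i
      by (simp add: cis_conv_exp mult_ac)
    then show ?thesis
      by (simp only: of_real_sum sum_distrib_left exp_sum finite_lessThan)
  qed
  have "complex_of_real (discrete_gaussian d t n)
        * exp (2 * pi * \<i> * of_real (\<Sum>i<d. real_of_int (n i) * \<xi> i))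
      = (\<Prod>i<d. ?e i (n i)) / complex_of_real (int_gauss_mass t ^ d)" for n
    unfolding char discrete_gaussian_def mass gauss_weight_eq_prod
    by (simp add: prod.distrib)
  then have "fourier d (\<lambda>n. complex_of_real (discrete_gaussian d t n)) \<xi>
      = (\<Sum>\<^sub>\<infinity>n\<in>lattice d. (\<Prod>i<d. ?e i (n i)) / complex_of_real (int_gauss_mass t ^ d))"
    unfolding fourier_def by (intro infsum_cong)
  also have "\<dots> = (\<Sum>\<^sub>\<infinity>n\<in>lattice d. \<Prod>i<d. ?e i (n i)) / complex_of_real (int_gauss_mass t ^ d)"
    unfolding divide_inverse by (rule infsum_cmult_left')
  also have "(\<Sum>\<^sub>\<infinity>n\<in>lattice d. \<Prod>i<d. ?e i (n i)) = (\<Prod>i<d. int_gauss_fourier t (\<xi> i))"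
    unfolding lattice_def int_gauss_fourier_def
    by (rule infsum_prod_PiE_abs) (use summ in \<open>auto simp: norm_mult\<close>)
  finally show ?thesis
    by (simp add: prod_dividef)
qed

theorem proposition5p1:
  fixes D :: real
  assumes "D > 0"
  shows "\<exists>c>0. \<forall>d\<ge>1. \<forall>t. 0 < t \<and> t \<le> D \<longrightarrow>
    (\<forall>\<xi>\<in>torus d. Re (fourier d (\<lambda>n. complex_of_real (discrete_gaussian d t n)) \<xi>)
       \<le> exp (- c * exp (- pi / t) * (euclid_norm d \<xi>)\<^sup>2))"
proof (intro exI[of _ "4 / int_gauss_mass D"] conjI allI impI ballI)
  show "0 < 4 / int_gauss_mass D"
    using int_gauss_mass_pos[OF assms] by simp
next
  fix d :: nat and t :: real and \<xi> :: "nat \<Rightarrow> real"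
  assume t: "0 < t \<and> t \<le> D" and \<xi>: "\<xi> \<in> torus d"
  let ?F = "fourier d (\<lambda>n. complex_of_real (discrete_gaussian d t n)) \<xi>"
  have mass: "0 < int_gauss_mass t" "int_gauss_mass t \<le> int_gauss_mass D"
    using t int_gauss_mass_pos int_gauss_mass_mono by auto
  have "Re ?F \<le> norm ?F"
    by (rule complex_Re_le_cmod)
  also have "\<dots> = (\<Prod>i<d. norm (int_gauss_fourier t (\<xi> i)) / int_gauss_mass t)"
    using t mass
    by (simp only: fourier_discrete_gaussian norm_divide norm_of_real abs_of_pos flip: prod_norm)
  also have "\<dots> \<le> (\<Prod>i<d. exp (- (4 / int_gauss_mass t) * exp (- pi / t) * (\<xi> i)\<^sup>2))"
  proof (rule prod_mono)
    fix i assume "i \<in> {..<d}"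
    then have "\<xi> i \<in> {-1/2..<1/2}"
      by (rule PiE_mem[OF \<xi>[unfolded torus_def]])
    then have "\<bar>\<xi> i\<bar> \<le> 1 / 2" by auto
    moreover have "0 \<le> norm (int_gauss_fourier t (\<xi> i)) / int_gauss_mass t"
      using mass(1) by simp
    ultimately show "0 \<le> norm (int_gauss_fourier t (\<xi> i)) / int_gauss_mass t \<and>
        norm (int_gauss_fourier t (\<xi> i)) / int_gauss_mass t
          \<le> exp (- (4 / int_gauss_mass t) * exp (- pi / t) * (\<xi> i)\<^sup>2)"
      using norm_int_gauss_fourier_le t by blast
  qed
  also have "\<dots> = exp (- (4 / int_gauss_mass t) * exp (- pi / t) * (euclid_norm d \<xi>)\<^sup>2)"
    unfolding euclid_norm_power2 sum_distrib_left by (simp only: exp_sum finite_lessThan)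
  also have "\<dots> \<le> exp (- (4 / int_gauss_mass D) * exp (- pi / t) * (euclid_norm d \<xi>)\<^sup>2)"
  proof -
    have "4 / int_gauss_mass D \<le> 4 / int_gauss_mass t"
      using mass by (intro divide_left_mono mult_pos_pos) auto
    then have "4 / int_gauss_mass D * (exp (- pi / t) * (euclid_norm d \<xi>)\<^sup>2)
        \<le> 4 / int_gauss_mass t * (exp (- pi / t) * (euclid_norm d \<xi>)\<^sup>2)"
      by (intro mult_right_mono) auto
    then show ?thesis by (simp only: exp_le_cancel_iff mult.assoc mult_minus_left neg_le_iff_le)
  qed
  finally show "Re ?F \<le> exp (- (4 / int_gauss_mass D) * exp (- pi / t) * (euclid_norm d \<xi>)\<^sup>2)" .
qed

end
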